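(* Let $\gamma(t)=(\beta(t),z(t))\in H_n\cong\mathbb{C}^n\times\mathbb{R}$ be a degenerate horizontally regular curve. Then there exists a symmetry $\Phi\in PSH(n)$ such that $\Phi\circ\gamma=\widetilde\gamma$, where $\widetilde\gamma(t)=(\widetilde\beta(t),z(t))$ is a horizontally regular curve (with the same last coordinate $z(t)$) whose projection to $\mathbb{C}^n$ has the form $\widetilde\beta=(\widetilde\beta_1,\dots,\widetilde\beta_{n-1},0)$. Thus $\widetilde\gamma$ lies in $H_{n-1}\subset H_n$.
   Context: Heisenberg group. $H_n$ $(n\ge1)$ is $\mathbb{R}^{2n+1}$ with coordinates $(x_1,\dots,x_n,y_1,\dots,y_n,z)$ and group law $(x,y,z)\circ(\tilde x,\tilde y,\tilde z)=(x+\tilde x,\,y+\tilde y,\,z+\tilde z+\sum_{j=1}^n(y_j\tilde x_j-x_j\tilde y_j))$. Left invariant vector fields: $\mathring e_j=\partial_{x_j}+y_j\partial_z$, $\mathring e_{n+j}=\partial_{y_j}-x_j\partial_z$ $(1\le j\le n)$, $T=\partial_z$. The contact bundle $\xi$ is spanned by $\mathring e_1,\dots,\mathring e_{2n}$; it is the kernel of $\theta=dz+\sum_{j=1}^n(x_j\,dy_j-y_j\,dx_j)$. The almost complex structure $J$ on $\xi$ is $J\mathring e_j=\mathring e_{n+j}$, $J\mathring e_{n+j}=-\mathring e_j$. One identifies $H_n\cong\mathbb{C}^n\times\mathbb{R}$ via $z_j=x_j+\sqrt{-1}\,y_j$, and $H_{n-1}$ with the subset of $H_n$ where $x_n=y_n=0$.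 $PSH(n)$ (the group of rigid motions, or symmetries) is the group of diffeomorphisms $\Phi:H_n\to H_n$ with $\Phi_*(\xi)=\xi$, $\Phi_*J=J\Phi_*$ on $\xi$, and $\Phi^*\theta=\theta$. Curves. A smooth curve $\gamma(t)=(x_1(t),\dots,x_n(t),y_1(t),\dots,y_n(t),z(t))$, $t\in I$ (an interval), is written $\gamma=(\beta,z)$ with $\beta(t)=(z_1(t),\dots,z_n(t))\in\mathbb{C}^n$, $z_j=x_j+\sqrt{-1}\,y_j$. It is horizontally regular if the $\xi$-component $\gamma'_\xi$ of $\gamma'$ along $T$ is nonzero for all $t$, equivalently $\beta'(t)\neq0$ for all $t$. Order. A horizontally regular curve $\gamma=(\beta,z)$ in $H_n$ is of order $k$, for an integer $k\in[1,n]$, if for all $t$ $$\beta'(t)\wedge\cdots\wedge\beta^{(k+1)}(t)=0\quad\text{and}\quad \beta'(t)\wedge\cdots\wedge\beta^{(k)}(t)\neq0,$$ where the wedge product is over $\mathbb{C}$ in $\mathbb{C}^n$. The curve is degenerate in $H_n$ if it has an order and $\mathrm{order}(\gamma)<n$. *)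

theory Defs
  imports "HOL-Analysis.Analysis" "HOL-Combinatorics.Permutations"
begin

section \<open>The Heisenberg group\<close>

text \<open>
  A point of the Heisenberg group is a triple (x, y, z), and n is the cardinality of the
  index type. Since the space is a vector space, all tangent spaces are identified with the
  space itself. The index type carries a linear order so that it has a last index.
\<close>

type_synonym 'n heis = "(real^'n) \<times> (real^'n) \<times> real"

definition xc :: "'n heis \<Rightarrow> real^'n" where
  "xc p = fst p"

definition yc :: "'n heis \<Rightarrow> real^'n" where
  "yc p = fst (snd p)"

definition zc :: "'n heis \<Rightarrow> real" where
  "zc p = snd (snd p)"

definition cproj :: "'n::finite heis \<Rightarrow> complex^'n" where
  "cproj p = (\<chi> j. Complex (xc p $ j) (yc p $ j))"

definition last_index :: "'n::{finite,linorder}" where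
  "last_index = Max UNIV"

text \<open>The copy of the Heisenberg group of one complex dimension less.\<close>

definition sub_heis :: "'n::{finite,linorder} heis set" where
  "sub_heis = {p. xc p $ last_index = 0 \<and> yc p $ last_index = 0}"

definition ex :: "'n::finite \<Rightarrow> 'n heis \<Rightarrow> 'n heis" where
  "ex j p = (axis j 1, 0, yc p $ j)"

definition ey :: "'n::finite \<Rightarrow> 'n heis \<Rightarrow> 'n heis" where
  "ey j p = (0, axis j 1, - (xc p $ j))"

definition Tfield :: "'n::finite heis \<Rightarrow> 'n heis" where
  "Tfield p = (0, 0, 1)"

definition xi :: "'n::finite heis \<Rightarrow> 'n heis set" where
  "xi p = span (range (\<lambda>j. ex j p) \<union> range (\<lambda>j. ey j p))"

definition theta :: "'n::finite heis \<Rightarrow> 'n heis \<Rightarrow> real" where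
  "theta p v = zc v + (\<Sum>j\<in>UNIV. xc p $ j * yc v $ j - yc p $ j * xc v $ j)"

text \<open>
  A vector v of the contact plane is the combination of the frame with coefficients
  given by the first two blocks of v, so this is the linear map with the values on the frame
  stated in the lemmas below. It is only meaningful on the contact plane.
\<close>

definition J :: "'n::finite heis \<Rightarrow> 'n heis \<Rightarrow> 'n heis" where
  "J p v = (\<Sum>j\<in>UNIV. (xc v $ j) *\<^sub>R ey j p - (yc v $ j) *\<^sub>R ex j p)"

lemma linear_J: "linear (J p)"
  by (rule linearI)
    (simp_all add: J_def xc_def yc_def scaleR_add_left scaleR_diff_right
      scaleR_sum_right sum.distrib sum_subtractf)

lemma J_ex: "J p (ex j p) = ey j p"
proof -
  have "J p (ex j p) = (\<Sum>i\<in>UNIV. if j = i then ey i p else 0)"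
    unfolding J_def by (rule sum.cong) (auto simp: ex_def xc_def yc_def axis_def zero_prod_def)
  then show ?thesis by simp
qed

lemma J_ey: "J p (ey j p) = - ex j p"
proof -
  have "J p (ey j p) = (\<Sum>i\<in>UNIV. if j = i then - ex i p else 0)"
    unfolding J_def by (rule sum.cong) (auto simp: ey_def xc_def yc_def axis_def zero_prod_def)
  then show ?thesis by simp
qed

lemma frame_expansion:
  assumes "theta p v = 0"
  shows "v = (\<Sum>j\<in>UNIV. (xc v $ j) *\<^sub>R ex j p + (yc v $ j) *\<^sub>R ey j p)" (is "v = ?w")
proof -
  have f: "fst ?w = xc v"
    by (simp add: fst_sum ex_def ey_def vec_eq_iff axis_def if_distrib[of "\<lambda>u. _ * u"] cong: if_cong)
  have s: "fst (snd ?w) = yc v"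
    by (simp add: fst_sum snd_sum ex_def ey_def vec_eq_iff axis_def if_distrib[of "\<lambda>u. _ * u"] cong: if_cong)
  have z: "snd (snd ?w) = zc v"
    using assms
    by (simp add: snd_sum ex_def ey_def theta_def sum.distrib sum_subtractf sum_negf algebra_simps)
  show ?thesis
    using f s z by (simp add: prod_eq_iff xc_def yc_def zc_def)
qed

lemma linear_theta: "linear (theta p)"
  by (rule linearI)
    (simp_all add: theta_def xc_def yc_def zc_def sum.distrib sum_subtractf
      sum_distrib_left algebra_simps)

lemma xi_eq_kernel: "xi p = {v. theta p v = 0}"
proof
  have "theta p (ex j p) = 0" "theta p (ey j p) = 0" for j
    by (simp_all add: theta_def ex_def ey_def xc_def yc_def zc_def axis_def
        if_distrib[of "\<lambda>u. _ * u"] sum_negf cong: if_cong)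
  moreover have "subspace {v. theta p v = 0}"
    by (rule subspaceI)
      (simp_all add: linear_0[OF linear_theta] linear_add[OF linear_theta] linear_scale[OF linear_theta])
  ultimately show "xi p \<subseteq> {v. theta p v = 0}"
    unfolding xi_def by (intro span_minimal) auto
next
  show "{v. theta p v = 0} \<subseteq> xi p"
  proof
    fix v assume "v \<in> {v. theta p v = 0}"
    then have *: "v = (\<Sum>j\<in>UNIV. (xc v $ j) *\<^sub>R ex j p + (yc v $ j) *\<^sub>R ey j p)"
      by (intro frame_expansion) simp
    have "(\<Sum>j\<in>UNIV. (xc v $ j) *\<^sub>R ex j p + (yc v $ j) *\<^sub>R ey j p) \<in> xi p"
      unfolding xi_def by (intro span_sum span_add span_scale span_base) auto
    with * show "v \<in> xi p" by simp
  qed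
qed

text \<open>The component in the contact plane of a tangent vector, along the direction of T.\<close>

definition xi_part :: "'n::finite heis \<Rightarrow> 'n heis \<Rightarrow> 'n heis" where
  "xi_part p v = v - theta p v *\<^sub>R Tfield p"

lemma xi_part_unique:
  "w = xi_part p v \<longleftrightarrow> w \<in> xi p \<and> (\<exists>c. v = w + c *\<^sub>R Tfield p)"
proof -
  have T: "theta p (Tfield p) = 1"
    by (simp add: theta_def Tfield_def xc_def yc_def zc_def)
  have "theta p (xi_part p v) = 0"
    by (simp add: xi_part_def linear_diff[OF linear_theta] linear_scale[OF linear_theta] T)
  moreover have "w = xi_part p v" if "theta p w = 0" "v = w + c *\<^sub>R Tfield p" for c
    using that
    by (simp add: xi_part_def linear_add[OF linear_theta] linear_scale[OF linear_theta] T)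
  ultimately show ?thesis
    by (auto simp: xi_eq_kernel xi_part_def intro: exI[of _ "theta p v"])
qed

section \<open>Rigid motions\<close>

primrec C_diff :: "nat \<Rightarrow> ('a::euclidean_space \<Rightarrow> 'b::euclidean_space) \<Rightarrow> bool" where
  "C_diff 0 f \<longleftrightarrow> continuous_on UNIV f"
| "C_diff (Suc m) f \<longleftrightarrow>
     (\<forall>x. f differentiable (at x)) \<and> (\<forall>v. C_diff m (\<lambda>x. frechet_derivative f (at x) v))"

definition smooth_map :: "('a::euclidean_space \<Rightarrow> 'b::euclidean_space) \<Rightarrow> bool" where
  "smooth_map f \<longleftrightarrow> (\<forall>m. C_diff m f)"

definition diffeomorphism :: "('a::euclidean_space \<Rightarrow> 'b::euclidean_space) \<Rightarrow> bool" where
  "diffeomorphism f \<longleftrightarrow> bij f \<and> smooth_map f \<and> smooth_map (inv f)"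

definition PSH :: "('n::finite heis \<Rightarrow> 'n heis) set" where
  "PSH = {\<Phi>. diffeomorphism \<Phi> \<and>
     (\<forall>p. frechet_derivative \<Phi> (at p) ` xi p = xi (\<Phi> p)) \<and>
     (\<forall>p. \<forall>v\<in>xi p. frechet_derivative \<Phi> (at p) (J p v) = J (\<Phi> p) (frechet_derivative \<Phi> (at p) v)) \<and>
     (\<forall>p v. theta (\<Phi> p) (frechet_derivative \<Phi> (at p) v) = theta p v)}"

section \<open>Curves\<close>

text \<open>
  Intervals may be open, closed or half-open; they are required to have more than one point,
  which makes the derivatives relative to the interval (one-sided at endpoints) unique.
  Values of a curve outside its interval are irrelevant.
\<close>

definition curve_interval :: "real set \<Rightarrow> bool" where
  "curve_interval I \<longleftrightarrow> is_interval I \<and> interior I \<noteq> {}"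

primrec nderiv :: "real set \<Rightarrow> nat \<Rightarrow> (real \<Rightarrow> 'a::real_normed_vector) \<Rightarrow> real \<Rightarrow> 'a" where
  "nderiv I 0 f = f"
| "nderiv I (Suc m) f = (\<lambda>t. vector_derivative (nderiv I m f) (at t within I))"

definition smooth_curve :: "real set \<Rightarrow> (real \<Rightarrow> 'a::real_normed_vector) \<Rightarrow> bool" where
  "smooth_curve I f \<longleftrightarrow> (\<forall>m. \<forall>t\<in>I. nderiv I m f differentiable (at t within I))"

definition horizontally_regular :: "real set \<Rightarrow> (real \<Rightarrow> 'n::finite heis) \<Rightarrow> bool" where
  "horizontally_regular I \<gamma> \<longleftrightarrow>
     smooth_curve I \<gamma> \<and> (\<forall>t\<in>I. xi_part (\<gamma> t) (nderiv I 1 \<gamma> t) \<noteq> 0)"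

text \<open>
  The wedge product of v 1, ..., v k, represented by the components of the corresponding
  alternating tensor: the component at (i 1, ..., i k) is the minor of the vectors with
  these rows. Values of i outside {1..k} are irrelevant. The empty product is 1.
\<close>

definition wedge :: "nat \<Rightarrow> (nat \<Rightarrow> complex^'n) \<Rightarrow> (nat \<Rightarrow> 'n) \<Rightarrow> complex" where
  "wedge k v = (\<lambda>i. \<Sum>\<sigma> | \<sigma> permutes {1..k}. of_int (sign \<sigma>) * (\<Prod>a\<in>{1..k}. v (\<sigma> a) $ i a))"

definition has_order :: "real set \<Rightarrow> (real \<Rightarrow> 'n::finite heis) \<Rightarrow> nat \<Rightarrow> bool" where
  "has_order I \<gamma> k \<longleftrightarrow> 1 \<le> k \<and> k \<le> CARD('n) \<and>
     (\<forall>t\<in>I. wedge (k + 1) (\<lambda>m. nderiv I m (cproj \<circ> \<gamma>) t) = (\<lambda>_. 0) \<and>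
            wedge k (\<lambda>m. nderiv I m (cproj \<circ> \<gamma>) t) \<noteq> (\<lambda>_. 0))"

definition degenerate :: "real set \<Rightarrow> (real \<Rightarrow> 'n::finite heis) \<Rightarrow> bool" where
  "degenerate I \<gamma> \<longleftrightarrow> (\<exists>k. has_order I \<gamma> k \<and> k < CARD('n))"

end

theory Submission
  imports Defs
begin

text \<open>
  Write \<beta> for the projection of the curve to complex n-space. If its order k is less than n, its
  first k derivatives span a k-dimensional complex subspace V(t), and the vanishing of the next
  wedge product puts the derivative of order k + 1 back into V(t). So the first k derivatives
  solve a linear homogeneous system with continuous coefficients, and V(t) does not depend
  on t. Concretely, choose a unit vector w that is Hermitian orthogonal to the first k derivatives
  at one time t0, which is possible because k < n. The functions
  \<open>herm (nderiv I m \<beta> t) w\<close> with m = 1, ..., k solve that system and vanish at t0, hence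
  vanish on the whole interval (\<open>herm_derivatives_vanish\<close>). In particular
  \<open>herm (\<beta> t) w\<close> is a constant c: the projection stays in a complex affine hyperplane.

  A unitary map U that sends w to the last basis vector e turns this hyperplane into the one where
  the last coordinate is c. Multiplying w by a phase makes its last coordinate real, and then a
  single Hermitian reflection serves as U (\<open>reflect_component\<close>). The rigid motion is U
  followed by the left translation by (-c e, 0) (\<open>unitary.motion_in_PSH\<close>). The translation
  changes the real coordinate by the symplectic pairing of -c e with \<open>U (\<beta> t)\<close>. Only the
  last components contribute to the pairing, and its value is the imaginary part of -c times the
  conjugate of c, which is 0. This is why the coordinate z is preserved exactly.
\<close>

section \<open>Hermitian reflections\<close>

definition herm :: "complex^'n::finite \<Rightarrow> complex^'n \<Rightarrow> complex" where
  "herm a b = (\<Sum>j\<in>UNIV. a $ j * cnj (b $ j))"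

lemma scaleR_eq_scalar_mult: "r *\<^sub>R a = of_real r *s a" for a :: "complex^'n"
  by (simp add: vec_eq_iff complex_eq_iff)

lemma herm_add_left: "herm (a + b) c = herm a c + herm b c"
  and herm_add_right: "herm a (b + c) = herm a b + herm a c"
  and herm_diff_left: "herm (a - b) c = herm a c - herm b c"
  and herm_diff_right: "herm a (b - c) = herm a b - herm a c"
  and herm_scale_left: "herm (s *s a) c = s * herm a c"
  and herm_scale_right: "herm a (s *s c) = cnj s * herm a c"
  and herm_scaleR_left: "herm (r *\<^sub>R a) c = r *\<^sub>R herm a c"
  by (simp_all add: herm_def sum.distrib sum_subtractf sum_distrib_left scaleR_sum_right algebra_simps)

lemma herm_commute: "cnj (herm a b) = herm b a"
  by (simp add: herm_def mult.commute)

lemma herm_self: "herm a a = of_real ((norm a)\<^sup>2)"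
  by (simp add: herm_def norm_vec_def L2_set_def sum_nonneg complex_norm_square[symmetric])

lemma Re_herm: "Re (herm a b) = a \<bullet> b"
  by (simp add: herm_def inner_vec_def inner_complex_def)

lemma herm_axis_right: "herm a (axis j 1) = a $ j"
  by (simp add: herm_def axis_def if_distrib[of cnj] if_distrib[of "\<lambda>u. _ * u"] cong: if_cong)

lemma bounded_linear_herm_left: "bounded_linear (\<lambda>a. herm a w)"
  by (intro linear_conv_bounded_linear[THEN iffD1] linearI)
    (simp_all add: herm_add_left herm_scaleR_left)

text \<open>
  The reflection in the complex hyperplane orthogonal to v. For v = 0 the quotient is 0, so the
  map is the identity; \<open>reflect_diff_axis\<close> relies on this when w is already the axis vector.
\<close>

definition reflect :: "complex^'n::finite \<Rightarrow> complex^'n \<Rightarrow> complex^'n" where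
  "reflect v x = x - (2 * herm x v / herm v v) *s v"

lemma reflect_add: "reflect v (a + b) = reflect v a + reflect v b"
  by (simp add: reflect_def herm_add_left vec_eq_iff add_divide_distrib algebra_simps)

lemma reflect_scale: "reflect v (s *s a) = s *s reflect v a"
  by (simp add: reflect_def herm_scale_left vec_eq_iff algebra_simps)

lemma herm_reflect_left: "herm (reflect v x) y = herm x (reflect v y)"
  by (simp add: reflect_def herm_diff_left herm_diff_right herm_scale_left herm_scale_right herm_commute)

lemma reflect_reflect: "reflect v (reflect v x) = x"
proof (cases "v = 0")
  case True
  then show ?thesis by (simp add: reflect_def)
next
  case False
  then have "herm v v \<noteq> 0" by (simp add: herm_self)
  then show ?thesis
    by (simp add: reflect_def herm_diff_left herm_scale_left vec_eq_iff)
qed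

lemma herm_reflect_reflect: "herm (reflect v x) (reflect v y) = herm x y"
  by (simp add: herm_reflect_left reflect_reflect)

text \<open>
  Two vectors of equal length are exchanged by the reflection along their difference as soon as
  their Hermitian product is real. The reality condition cannot be avoided: reflections are self-adjoint, so the
  product of a vector with its own reflection is always real.
\<close>

lemma reflect_diff_axis:
  assumes w: "herm w w = 1" and r: "w $ j \<in> \<real>"
  shows "reflect (w - axis j 1) (axis j 1) = w"
proof -
  define v where "v = w - axis j 1"
  have c: "cnj (w $ j) = w $ j" using r by (simp add: Reals_cnj_iff)
  have ew: "herm (axis j 1) w = w $ j"
    using herm_commute[of w "axis j 1"] by (simp add: herm_axis_right c)
  have ee: "herm (axis j 1) (axis j 1) = 1"
    unfolding herm_axis_right by (simp add: axis_def)
  have ev: "herm (axis j 1) v = w $ j - 1"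
    by (simp add: v_def herm_diff_right ew ee)
  have vv: "herm v v = 2 * (1 - w $ j)"
    by (simp add: v_def herm_diff_right herm_diff_left ew ee w)
      (simp add: herm_axis_right)
  show ?thesis
  proof (cases "w $ j = 1")
    case True
    then have "v = 0" using vv by (simp add: herm_self)
    then show ?thesis by (simp add: reflect_def v_def)
  next
    case False
    then have "2 * herm (axis j 1) v / herm v v = -1"
      unfolding ev vv by (simp add: field_simps)
    then show ?thesis by (simp add: reflect_def v_def[symmetric]) (simp add: v_def vec_eq_iff)
  qed
qed

lemma reflect_component:
  assumes "herm w w = 1" and "w $ j \<in> \<real>"
  shows "reflect (w - axis j 1) x $ j = herm x w"
  using herm_reflect_left[of "w - axis j 1" x "axis j 1"]
  by (simp add: reflect_diff_axis[OF assms] herm_axis_right)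

text \<open>
  Hermitian orthogonality to v m amounts to real orthogonality to v m and to i times v m. These
  are at most 2 k real conditions in a real space of dimension 2 n. The remaining freedom of a
  phase factor is used to make one chosen component real.
\<close>

lemma exists_unit_orthogonal:
  fixes v :: "nat \<Rightarrow> complex^'n::finite"
  assumes "k < CARD('n)"
  shows "\<exists>w. herm w w = 1 \<and> w $ j \<in> \<real> \<and> (\<forall>m\<in>{1..k}. herm (v m) w = 0)"
proof -
  define S where "S = v ` {1..k} \<union> (\<lambda>m. \<i> *s v m) ` {1..k}"
  have fin: "finite S" by (simp add: S_def)
  have "card S \<le> k + k"
    unfolding S_def by (intro order.trans[OF card_Un_le] add_mono order.trans[OF card_image_le]) auto
  also have "k + k < DIM(complex^'n)" using assms by simp
  finally have "dim S < DIM(complex^'n)"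
    using dim_le_card'[OF fin] by linarith
  then obtain x where x: "x \<noteq> 0" "\<And>y. y \<in> span S \<Longrightarrow> orthogonal x y"
    using orthogonal_to_subspace_exists by blast
  have hx: "herm (v m) x = 0" if "m \<in> {1..k}" for m
  proof (rule complex_eqI)
    have "orthogonal x (v m)" "orthogonal x (\<i> *s v m)"
      using that by (auto intro!: x(2) span_base simp: S_def)
    then have "Re (herm (v m) x) = 0" "Re (herm (\<i> *s v m) x) = 0"
      by (simp_all add: Re_herm orthogonal_def inner_commute)
    then show "Re (herm (v m) x) = Re 0" "Im (herm (v m) x) = Im 0"
      by (simp_all add: herm_scale_left)
  qed
  define c where "c = (if x $ j = 0 then 1 else cnj (x $ j) / of_real (norm (x $ j)))"
  have "norm c = 1" by (simp add: c_def norm_divide)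
  then have c1: "c * cnj c = 1" using complex_norm_square[of c] by simp
  have cr: "c * x $ j \<in> \<real>" by (simp add: c_def complex_is_Real_iff)
  define w where "w = (c / of_real (norm x)) *s x"
  have "herm w w = (c * cnj c) * (herm x x / (of_real (norm x))\<^sup>2)"
    unfolding w_def herm_scale_left herm_scale_right by (simp add: power2_eq_square)
  then have "herm w w = 1" using x(1) c1 by (simp add: herm_self)
  moreover have "w $ j \<in> \<real>"
  proof -
    have "w $ j = (c * x $ j) / of_real (norm x)" by (simp add: w_def)
    then show ?thesis using cr by simp
  qed
  moreover have "\<forall>m\<in>{1..k}. herm (v m) w = 0"
    using hx by (simp add: w_def herm_scale_right)
  ultimately show ?thesis by blast
qed

section \<open>Linear differential systems and the osculating space\<close>

text \<open>
  The coefficient of v m in the Laplace expansion of the minor of order k + 1 along its last row. Grouping the permutations by the image of k + 1 absorbs the cofactor sign into the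
  sign of the permutation, so no reindexing of the remaining k columns is required.
\<close>

definition last_cofactor :: "nat \<Rightarrow> (nat \<Rightarrow> complex^'n) \<Rightarrow> (nat \<Rightarrow> 'n) \<Rightarrow> nat \<Rightarrow> complex" where
  "last_cofactor k v i m = (\<Sum>\<sigma> | \<sigma> permutes {1..k+1} \<and> \<sigma> (k+1) = m.
     of_int (sign \<sigma>) * (\<Prod>a\<in>{1..k}. v (\<sigma> a) $ i a))"

lemma last_cofactor_last: "last_cofactor k v i (k+1) = wedge k v i"
proof -
  have "\<sigma> permutes {1..k+1} \<and> \<sigma> (k+1) = k+1 \<longleftrightarrow> \<sigma> permutes {1..k}" for \<sigma>
  proof
    assume *: "\<sigma> permutes {1..k+1} \<and> \<sigma> (k+1) = k+1"
    show "\<sigma> permutes {1..k}"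
    proof (rule permutes_superset)
      show "\<sigma> permutes {1..k+1}" using * ..
      fix x assume "x \<in> {1..k+1} - {1..k}"
      then have "x = k+1" by auto
      then show "\<sigma> x = x" using * by simp
    qed
  next
    assume *: "\<sigma> permutes {1..k}"
    have "\<sigma> permutes {1..k+1}" by (rule permutes_subset[OF *]) auto
    moreover have "\<sigma> (k+1) = k+1" by (rule permutes_not_in[OF *]) simp
    ultimately show "\<sigma> permutes {1..k+1} \<and> \<sigma> (k+1) = k+1" ..
  qed
  then show ?thesis unfolding last_cofactor_def wedge_def by simp
qed

lemma wedge_Suc_expand:
  "wedge (k+1) v (i(k+1 := r)) = (\<Sum>m=1..k+1. last_cofactor k v i m * v m $ r)"
proof -
  let ?P = "{\<sigma>. \<sigma> permutes {1..k+1}}"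
  let ?g = "\<lambda>\<sigma>. of_int (sign \<sigma>) * (\<Prod>a\<in>{1..k}. v (\<sigma> a) $ i a)"
  have fin: "finite ?P" by (simp add: finite_permutations)
  have "wedge (k+1) v (i(k+1 := r)) = (\<Sum>\<sigma>\<in>?P. ?g \<sigma> * v (\<sigma> (k+1)) $ r)"
    unfolding wedge_def by (intro sum.cong) (auto simp: atLeastAtMostSuc_conv intro!: prod.cong)
  also have "\<dots> = (\<Sum>m=1..k+1. \<Sum>\<sigma>\<in>{\<sigma>\<in>?P. \<sigma> (k+1) = m}. ?g \<sigma> * v (\<sigma> (k+1)) $ r)"
  proof (rule sum.group[symmetric, OF fin])
    show "(\<lambda>\<sigma>. \<sigma> (k+1)) ` ?P \<subseteq> {1..k+1}"
      using permutes_in_image[of _ "{1..k+1}" "k+1"] by auto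
  qed simp
  also have "\<dots> = (\<Sum>m=1..k+1. last_cofactor k v i m * v m $ r)"
    unfolding last_cofactor_def sum_distrib_right by (intro sum.cong) auto
  finally show ?thesis .
qed

text \<open>
  Keeping the first k row indices and letting the last one run through all components turns the
  vanishing minors into a vector identity: Cramer's rule for the last vector, with the
  denominator cleared. It is stated after pairing with w, the form in which it enters the
  differential system.
\<close>

lemma wedge_eq_0_imp_relation:
  assumes "wedge (k+1) v = (\<lambda>_. 0)"
  shows "wedge k v i * herm (v (k+1)) w = - (\<Sum>m=1..k. last_cofactor k v i m * herm (v m) w)"
proof -
  have "(\<Sum>m=1..k+1. last_cofactor k v i m * v m $ r) = 0" for r
    using wedge_Suc_expand[of k v i r] assms by simp
  then have *: "last_cofactor k v i (k+1) * v (k+1) $ r = - (\<Sum>m=1..k. last_cofactor k v i m * v m $ r)" for r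
    by (simp add: add_eq_0_iff)
  have "last_cofactor k v i (k+1) * herm (v (k+1)) w
      = (\<Sum>r\<in>UNIV. (last_cofactor k v i (k+1) * v (k+1) $ r) * cnj (w $ r))"
    by (simp add: herm_def sum_distrib_left mult_ac)
  also have "\<dots> = - (\<Sum>r\<in>UNIV. \<Sum>m=1..k. last_cofactor k v i m * v m $ r * cnj (w $ r))"
    by (simp only: *) (simp add: sum_distrib_right sum_negf)
  also have "\<dots> = - (\<Sum>m=1..k. last_cofactor k v i m * herm (v m) w)"
    by (subst sum.swap) (simp add: herm_def sum_distrib_left mult_ac)
  finally show ?thesis by (simp only: last_cofactor_last)
qed

text \<open>
  Local uniqueness for a linear system in companion form. If S is the sum of the norms, every
  derivative of a member of the chain is at most K S; on a segment starting at s and shorter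
  than \<epsilon>, the mean value inequality bounds the maximum of S by k K \<epsilon> times itself,
  which forces it to vanish once \<epsilon> is small.
\<close>

lemma derivative_chain_vanishes_nearby:
  fixes u :: "nat \<Rightarrow> real \<Rightarrow> 'a::real_normed_vector"
  assumes I: "is_interval I"
    and der: "\<And>m t. m \<in> {1..k} \<Longrightarrow> t \<in> I \<Longrightarrow> (u m has_vector_derivative u (m+1) t) (at t within I)"
    and bound: "\<And>t. t \<in> I \<Longrightarrow> \<bar>t - s\<bar> < \<delta> \<Longrightarrow> norm (u (k+1) t) \<le> L * (\<Sum>m=1..k. norm (u m t))"
    and \<delta>: "\<delta> > 0" and s: "s \<in> I" and zero: "\<And>m. m \<in> {1..k} \<Longrightarrow> u m s = 0"
  shows "\<exists>\<epsilon>>0. \<forall>t\<in>I. \<bar>t - s\<bar> < \<epsilon> \<longrightarrow> (\<forall>m\<in>{1..k}. u m t = 0)"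
proof -
  define S where "S t = (\<Sum>m=1..k. norm (u m t))" for t
  define K where "K = max 1 L"
  have K: "K \<ge> 1" "K \<ge> L" by (simp_all add: K_def)
  define Q where "Q = (real k + 1) * K"
  have Q: "Q > 0" using K by (simp add: Q_def)
  define \<epsilon> where "\<epsilon> = min \<delta> (1 / (2 * Q))"
  have \<epsilon>: "\<epsilon> > 0" using \<delta> Q by (simp add: \<epsilon>_def)
  have S0: "S t \<ge> 0" for t by (simp add: S_def sum_nonneg)
  have step: "norm (u (m+1) t) \<le> K * S t" if "m \<in> {1..k}" "t \<in> I" "\<bar>t - s\<bar> < \<delta>" for m t
  proof (cases "m = k")
    case True
    have "norm (u (k+1) t) \<le> L * S t" using bound that by (simp add: S_def)
    also have "\<dots> \<le> K * S t" using K S0 by (intro mult_right_mono)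
    finally show ?thesis using True by simp
  next
    case False
    then have "norm (u (m+1) t) \<le> S t"
      unfolding S_def using that by (intro member_le_sum) auto
    also have "\<dots> \<le> K * S t" using mult_right_mono[OF K(1) S0[of t]] by simp
    finally show ?thesis .
  qed
  have "continuous_on I (u m)" if "m \<in> {1..k}" for m
    using continuous_on_vector_derivative[OF der[OF that]] .
  then have contS: "continuous_on I S"
    unfolding S_def by (intro continuous_intros)
  have "S t = 0" if t: "t \<in> I" "\<bar>t - s\<bar> < \<epsilon>" for t
  proof -
    \<comment> \<open>The interval need not be closed; the segment is compact and lies in it.\<close>
    let ?C = "closed_segment s t"
    have C: "?C \<subseteq> I"
      using I s t by (metis closed_segment_subset is_interval_convex)
    have near: "\<bar>r - s\<bar> \<le> \<bar>t - s\<bar>" if "r \<in> ?C" for r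
      using segment_bound1[OF that] by (simp add: abs_minus_commute)
    obtain q where q: "q \<in> ?C" "\<And>r. r \<in> ?C \<Longrightarrow> S r \<le> S q"
      using continuous_attains_sup[OF compact_segment _ continuous_on_subset[OF contS C]] by auto
    have "norm (u m q) \<le> K * S q * \<epsilon>" if m: "m \<in> {1..k}" for m
    proof -
      have "norm (u m q - u m s) \<le> K * S q * norm (q - s)"
      proof (rule differentiable_bound[of ?C])
        fix r assume r: "r \<in> ?C"
        show "(u m has_derivative (\<lambda>h. h *\<^sub>R u (m+1) r)) (at r within ?C)"
          using der[OF m, of r] r C has_vector_derivative_within_subset
          unfolding has_vector_derivative_def by (blast intro: has_derivative_subset)
        have "norm (u (m+1) r) \<le> K * S r"
          using step[OF m] r C near[OF r] t by (auto simp: \<epsilon>_def)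
        also have "\<dots> \<le> K * S q" using q(2)[OF r] K by (intro mult_left_mono) auto
        finally have ub: "norm (u (m+1) r) \<le> K * S q" .
        show "onorm (\<lambda>h. h *\<^sub>R u (m+1) r) \<le> K * S q"
        proof (rule onorm_le)
          fix h :: real
          show "norm (h *\<^sub>R u (m+1) r) \<le> K * S q * norm h"
            using mult_right_mono[OF ub, of "\<bar>h\<bar>"] by (simp add: mult.commute)
        qed
      qed (use q in auto)
      also have "\<dots> \<le> K * S q * \<epsilon>"
        using near[OF q(1)] t K S0 by (intro mult_left_mono) auto
      finally show ?thesis using zero[OF m] by simp
    qed
    then have "S q \<le> (\<Sum>m=1..k. K * S q * \<epsilon>)"
      unfolding S_def[of q] by (intro sum_mono) (simp add: S_def)
    also have "\<dots> = S q * (real k * K * \<epsilon>)" by simp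
    also have "\<dots> \<le> S q * (1/2)"
    proof (intro mult_left_mono S0)
      have "real k * K * \<epsilon> \<le> Q * (1 / (2 * Q))"
        using K \<epsilon> by (intro mult_mono) (auto simp: \<epsilon>_def Q_def)
      also have "\<dots> = 1/2" using Q by simp
      finally show "real k * K * \<epsilon> \<le> 1/2" .
    qed
    finally have "S q \<le> 0" by simp
    then show ?thesis using q(2)[of t] S0[of t] by simp
  qed
  then show ?thesis
    using \<epsilon> by (intro exI[of _ \<epsilon>]) (auto simp: S_def sum_nonneg_eq_0_iff)
qed

text \<open>
  The common zero set of the chain is closed in the interval by continuity and open in it by local
  uniqueness. Only a local bound is available in the application, since the coefficients are
  quotients by a minor that is known to be nonzero only near s.
\<close>

lemma derivative_chain_vanishes:
  fixes u :: "nat \<Rightarrow> real \<Rightarrow> 'a::real_normed_vector"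
  assumes I: "is_interval I"
    and der: "\<And>m t. m \<in> {1..k} \<Longrightarrow> t \<in> I \<Longrightarrow> (u m has_vector_derivative u (m+1) t) (at t within I)"
    and bound: "\<And>s. s \<in> I \<Longrightarrow> \<exists>\<delta>>0. \<exists>L. \<forall>t\<in>I. \<bar>t - s\<bar> < \<delta> \<longrightarrow>
                  norm (u (k+1) t) \<le> L * (\<Sum>m=1..k. norm (u m t))"
    and t0: "t0 \<in> I" and zero: "\<And>m. m \<in> {1..k} \<Longrightarrow> u m t0 = 0"
    and t: "t \<in> I" and m: "m \<in> {1..k}"
  shows "u m t = 0"
proof -
  define Z where "Z = {t \<in> I. \<forall>m\<in>{1..k}. u m t = 0}"
  have conn: "connected I" using I by (simp add: is_interval_connected)
  have cont: "continuous_on I (u m)" if "m \<in> {1..k}" for m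
    using continuous_on_vector_derivative[OF der[OF that]] .
  have "closedin (top_of_set I) (I \<inter> (\<Inter>m\<in>{1..k}. {t \<in> I. u m t = 0}))"
  proof (cases "{1..k} = {}")
    case False
    have "closedin (top_of_set I) (\<Inter>m\<in>{1..k}. {t \<in> I. u m t = 0})"
      using False
      by (intro closedin_INT continuous_closedin_preimage_constant cont)
    then show ?thesis by (intro closedin_Int) auto
  qed (simp only: image_empty Inter_empty Int_UNIV_right closedin_topspace topspace_euclidean_subtopology; simp)
  also have "I \<inter> (\<Inter>m\<in>{1..k}. {t \<in> I. u m t = 0}) = Z" by (auto simp: Z_def)
  finally have cl: "closedin (top_of_set I) Z" .
  have op: "openin (top_of_set I) Z"
  proof -
    have "\<exists>e>0. \<forall>x'\<in>I. dist x' x < e \<longrightarrow> x' \<in> Z" if x: "x \<in> Z" for x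
    proof -
      have xI: "x \<in> I" and xz: "\<And>m. m \<in> {1..k} \<Longrightarrow> u m x = 0" using x by (auto simp: Z_def)
      obtain \<delta> L where d: "\<delta> > 0" "\<And>t. t \<in> I \<Longrightarrow> \<bar>t - x\<bar> < \<delta> \<Longrightarrow>
          norm (u (k+1) t) \<le> L * (\<Sum>m=1..k. norm (u m t))"
        using bound[OF xI] by blast
      show ?thesis
        using derivative_chain_vanishes_nearby[OF I der d(2) d(1) xI xz] by (auto simp: Z_def dist_real_def)
    qed
    then show ?thesis unfolding openin_euclidean_subtopology_iff by (auto simp: Z_def)
  qed
  have "Z \<noteq> {}" using t0 zero by (auto simp: Z_def)
  then have "Z = I" using conn cl op by (auto simp: connected_clopen)
  then have "t \<in> Z" using t by simp
  then show ?thesis using m by (simp add: Z_def)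
qed

section \<open>Iterated derivatives of curves\<close>

lemma curve_interval_at_within_neq_bot:
  assumes "curve_interval I" "t \<in> I"
  shows "at t within I \<noteq> bot"
proof -
  have I: "convex I" "interior I \<noteq> {}"
    using assms by (auto simp: curve_interval_def is_interval_convex)
  have "\<exists>a. I \<noteq> {a}" using I by auto
  have "I \<noteq> {t}" using I(2) by auto
  then have "t islimpt I"
    using assms(2) I(1) by (intro connected_imp_perfect convex_connected) auto
  then show ?thesis by (simp add: trivial_limit_within)
qed

lemma smooth_curve_has_vector_derivative:
  assumes "smooth_curve I f" "t \<in> I"
  shows "(nderiv I m f has_vector_derivative nderiv I (Suc m) f t) (at t within I)"
  using assms by (simp add: smooth_curve_def vector_derivative_works)

text \<open>
  The values of a curve outside the interval are arbitrary, so the induction compares the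
  derivatives relative to the interval, and uses that those are unique at each of its points.
\<close>

lemma nderiv_affine:
  assumes I: "curve_interval I" and f: "smooth_curve I f" and h: "bounded_linear h"
  shows "t \<in> I \<Longrightarrow> nderiv I m (\<lambda>t. c + h (f t)) t = (if m = 0 then c else 0) + h (nderiv I m f t)"
proof (induction m arbitrary: t)
  case (Suc m)
  have "((\<lambda>t. (if m = 0 then c else 0) + h (nderiv I m f t)) has_vector_derivative
      h (nderiv I (Suc m) f t)) (at t within I)"
    using bounded_linear.has_vector_derivative[OF h smooth_curve_has_vector_derivative[OF f Suc.prems, of m]]
    by (auto intro!: derivative_eq_intros)
  then have "(nderiv I m (\<lambda>t. c + h (f t)) has_vector_derivative h (nderiv I (Suc m) f t)) (at t within I)"
    using Suc.IH by (rule has_vector_derivative_transform[OF Suc.prems, rotated]) 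
  then show ?case
    using curve_interval_at_within_neq_bot[OF I Suc.prems]
    by (simp add: vector_derivative_within)
qed simp

lemma smooth_curve_affine:
  assumes I: "curve_interval I" and f: "smooth_curve I f" and h: "bounded_linear h"
  shows "smooth_curve I (\<lambda>t. c + h (f t))"
  unfolding smooth_curve_def
proof (intro allI ballI)
  fix m t assume t: "t \<in> I"
  have "((\<lambda>t. (if m = 0 then c else 0) + h (nderiv I m f t)) has_vector_derivative
      h (nderiv I (Suc m) f t)) (at t within I)"
    using bounded_linear.has_vector_derivative[OF h smooth_curve_has_vector_derivative[OF f t, of m]]
    by (auto intro!: derivative_eq_intros)
  then have "(nderiv I m (\<lambda>t. c + h (f t)) has_vector_derivative h (nderiv I (Suc m) f t)) (at t within I)"
    using nderiv_affine[OF I f h] by (rule has_vector_derivative_transform[OF t, rotated])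
  then show "nderiv I m (\<lambda>t. c + h (f t)) differentiable at t within I"
    by (rule differentiableI_vector)
qed

lemma continuous_on_nderiv: "smooth_curve I f \<Longrightarrow> continuous_on I (nderiv I m f)"
  by (rule continuous_on_vector_derivative[OF smooth_curve_has_vector_derivative])

text \<open>
  The osculating space is constant: a covector that kills it at one time kills it always. Near s
  some fixed minor D of the first k derivatives is nonzero, and the quotients of the cofactors
  by D are continuous at s, hence bounded nearby.
\<close>

lemma herm_derivatives_vanish:
  fixes \<beta> :: "real \<Rightarrow> complex^'n::finite"
  assumes I: "is_interval I" and \<beta>: "smooth_curve I \<beta>"
    and dep: "\<And>t. t \<in> I \<Longrightarrow> wedge (k+1) (\<lambda>m. nderiv I m \<beta> t) = (\<lambda>_. 0)"
    and indep: "\<And>t. t \<in> I \<Longrightarrow> wedge k (\<lambda>m. nderiv I m \<beta> t) \<noteq> (\<lambda>_. 0)"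
    and t0: "t0 \<in> I" and w: "\<And>m. m \<in> {1..k} \<Longrightarrow> herm (nderiv I m \<beta> t0) w = 0"
    and t: "t \<in> I" and m: "m \<in> {1..k}"
  shows "herm (nderiv I m \<beta> t) w = 0"
proof (rule derivative_chain_vanishes[where u = "\<lambda>m t. herm (nderiv I m \<beta> t) w", OF I _ _ t0 w t m])
  fix m t assume "t \<in> I"
  then show "((\<lambda>t. herm (nderiv I m \<beta> t) w) has_vector_derivative herm (nderiv I (m+1) \<beta> t) w)
      (at t within I)"
    using bounded_linear.has_vector_derivative[OF bounded_linear_herm_left
        smooth_curve_has_vector_derivative[OF \<beta>]] by simp
next
  fix s assume s: "s \<in> I"
  let ?v = "\<lambda>t m. nderiv I m \<beta> t"
  obtain i where i: "wedge k (?v s) i \<noteq> 0" using indep[OF s] by auto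
  define D where "D t = wedge k (?v t) i" for t
  define G where "G t = (\<Sum>m=1..k. norm (last_cofactor k (?v t) i m / D t))" for t
  have cv: "((\<lambda>t. ?v t m $ r) \<longlongrightarrow> ?v s m $ r) (at s within I)" for m r
    using continuous_on_nderiv[OF \<beta>, of m] s by (intro tendsto_vec_nth) (simp add: continuous_on_def)
  have cD: "(D \<longlongrightarrow> D s) (at s within I)"
    unfolding D_def wedge_def by (intro tendsto_intros cv)
  have cG: "(G \<longlongrightarrow> G s) (at s within I)"
    unfolding G_def last_cofactor_def by (intro tendsto_intros cv cD) (use i in \<open>simp add: D_def\<close>)
  have "eventually (\<lambda>t. G t < G s + 1 \<and> D t \<noteq> 0) (at s within I)"
    using order_tendstoD(2)[OF cG, of "G s + 1"] tendsto_imp_eventually_ne[OF cD, of 0] i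
    by (auto simp: D_def eventually_conj_iff)
  then obtain \<delta> where \<delta>: "\<delta> > 0"
    "\<And>t. t \<in> I \<Longrightarrow> t \<noteq> s \<Longrightarrow> dist t s < \<delta> \<Longrightarrow> G t < G s + 1 \<and> D t \<noteq> 0"
    by (auto simp: eventually_at)
  have "norm (herm (?v t (k+1)) w) \<le> (G s + 1) * (\<Sum>m=1..k. norm (herm (?v t m) w))"
    if t: "t \<in> I" "\<bar>t - s\<bar> < \<delta>" for t
  proof -
    have D0: "D t \<noteq> 0" and GG: "G t \<le> G s + 1"
      using \<delta>(2)[OF t(1)] t i by (cases "t = s"; force simp: dist_real_def D_def)+
    have "D t * herm (?v t (k+1)) w = - (\<Sum>m=1..k. last_cofactor k (?v t) i m * herm (?v t m) w)"
      unfolding D_def using dep[OF t(1)] by (rule wedge_eq_0_imp_relation)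
    then have "herm (?v t (k+1)) w = - (\<Sum>m=1..k. last_cofactor k (?v t) i m * herm (?v t m) w) / D t"
      using D0 by (simp add: field_simps)
    also have "\<dots> = - (\<Sum>m=1..k. (last_cofactor k (?v t) i m / D t) * herm (?v t m) w)"
      by (simp add: sum_divide_distrib)
    also have "norm \<dots> \<le> (\<Sum>m=1..k. norm (last_cofactor k (?v t) i m / D t) * norm (herm (?v t m) w))"
      unfolding norm_minus_cancel by (intro sum_norm_le) (simp add: norm_mult norm_divide)
    also have "\<dots> \<le> (\<Sum>m=1..k. (G s + 1) * norm (herm (?v t m) w))"
    proof (intro sum_mono mult_right_mono)
      fix m assume "m \<in> {1..k}"
      then have "norm (last_cofactor k (?v t) i m / D t) \<le> G t"
        unfolding G_def by (intro member_le_sum) auto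
      then show "norm (last_cofactor k (?v t) i m / D t) \<le> G s + 1" using GG by simp
    qed simp
    finally show ?thesis by (simp add: sum_distrib_left)
  qed
  then show "\<exists>\<delta>>0. \<exists>L. \<forall>t\<in>I. \<bar>t - s\<bar> < \<delta> \<longrightarrow> norm (herm (?v t (k+1)) w)
      \<le> L * (\<Sum>m=1..k. norm (herm (?v t m) w))"
    using \<delta>(1) by blast
qed

section \<open>Affine rigid motions\<close>

definition of_cproj :: "complex^'n::finite \<Rightarrow> real \<Rightarrow> 'n heis" where
  "of_cproj a z = ((\<chi> j. Re (a $ j)), (\<chi> j. Im (a $ j)), z)"

lemma cproj_of_cproj [simp]: "cproj (of_cproj a z) = a"
  and zc_of_cproj [simp]: "zc (of_cproj a z) = z"
  by (simp_all add: of_cproj_def cproj_def xc_def yc_def zc_def vec_eq_iff)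

lemma heis_eq_iff: "p = q \<longleftrightarrow> cproj p = cproj q \<and> zc p = zc q"
  by (auto simp: cproj_def xc_def yc_def zc_def vec_eq_iff prod_eq_iff)

lemma cproj_add: "cproj (p + q) = cproj p + cproj q"
  and cproj_diff: "cproj (p - q) = cproj p - cproj q"
  and cproj_scaleR: "cproj (r *\<^sub>R p) = r *\<^sub>R cproj p"
  and zc_add: "zc (p + q) = zc p + zc q"
  and zc_scaleR: "zc (r *\<^sub>R p) = r * zc p"
  by (simp_all add: cproj_def xc_def yc_def zc_def vec_eq_iff complex_eq_iff)

lemma linear_cproj: "linear cproj"
  by (rule linearI) (simp_all add: cproj_add cproj_scaleR)

text \<open>
  In complex notation the contact form involves only the imaginary part of the Hermitian product.
  This is what makes unitary maps preserve it.
\<close>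

lemma theta_eq: "theta p v = zc v - Im (herm (cproj p) (cproj v))"
  by (simp add: theta_def herm_def cproj_def sum_subtractf algebra_simps flip: sum_negf)

lemma cproj_J: "cproj (J p v) = \<i> *s cproj v"
proof -
  have "cproj (ex j p) = axis j 1" "cproj (ey j p) = axis j \<i>" for j
    by (auto simp: cproj_def ex_def ey_def xc_def yc_def axis_def vec_eq_iff complex_eq_iff)
  then have "cproj (J p v) =
      (\<Sum>j\<in>UNIV. (xc v $ j) *\<^sub>R axis j \<i> - (yc v $ j) *\<^sub>R axis j 1)"
    unfolding J_def by (simp add: linear_sum[OF linear_cproj] cproj_diff cproj_scaleR)
  also have "\<dots> = \<i> *s cproj v"
    by (simp add: vec_eq_iff axis_def cproj_def if_distrib[of "\<lambda>u. _ *\<^sub>R u"] sum_subtractf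
        complex_eq_iff cong: if_cong)
  finally show ?thesis .
qed

lemma J_in_xi: "J p v \<in> xi p"
  unfolding J_def xi_def by (intro span_sum span_diff span_scale span_base) auto

text \<open>
  The contact plane is a graph over complex n-space, so equality of contact vectors can be tested
  on their projections, where J is multiplication by i.
\<close>

lemma xi_eqI: "v \<in> xi p \<Longrightarrow> w \<in> xi p \<Longrightarrow> cproj v = cproj w \<Longrightarrow> v = w"
  by (simp add: xi_eq_kernel theta_eq heis_eq_iff)

lemma C_diff_const: "C_diff m (\<lambda>x. c)"
  by (induction m arbitrary: c) simp_all

lemma has_derivative_affine:
  fixes L :: "'a::euclidean_space \<Rightarrow> 'b::euclidean_space"
  assumes "linear L" shows "((\<lambda>x. c + L x) has_derivative L) (at x)"
  using has_derivative_add[OF has_derivative_const bounded_linear_imp_has_derivative, of L c "at x"] assms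
  by (simp add: linear_conv_bounded_linear)

lemma frechet_derivative_affine:
  fixes L :: "'a::euclidean_space \<Rightarrow> 'b::euclidean_space"
  assumes "linear L" shows "frechet_derivative (\<lambda>x. c + L x) (at x) = L"
  by (rule frechet_derivative_at[OF has_derivative_affine[OF assms], symmetric])

lemma smooth_map_affine:
  fixes L :: "'a::euclidean_space \<Rightarrow> 'b::euclidean_space"
  assumes "linear L" shows "smooth_map (\<lambda>x. c + L x)"
  unfolding smooth_map_def
proof
  fix m show "C_diff m (\<lambda>x. c + L x)"
  proof (cases m)
    case 0
    then show ?thesis
      using assms
      by (simp add: continuous_on_add linear_continuous_on linear_conv_bounded_linear)
  next
    case (Suc m')
    then show ?thesis
      using has_derivative_affine[OF assms]
      by (auto simp: frechet_derivative_affine[OF assms] C_diff_const differentiable_def)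
  qed
qed

lemma diffeomorphism_affine:
  fixes L :: "'a::euclidean_space \<Rightarrow> 'a"
  assumes L: "linear L" "inj L"
  shows "diffeomorphism (\<lambda>x. c + L x)"
proof -
  obtain M where M: "linear M" "\<And>x. M (L x) = x" "\<And>x. L (M x) = x"
    using linear_injective_isomorphism[OF L] by blast
  have bij: "bij (\<lambda>x. c + L x)"
    by (rule bij_betw_byWitness[of _ "\<lambda>y. M (y - c)"]) (auto simp: M)
  have "inv (\<lambda>x. c + L x) = (\<lambda>y. - M c + M y)"
    by (rule inv_unique_comp) (auto simp: M fun_eq_iff linear_add[OF M(1)] linear_add[OF L(1)] linear_diff[OF L(1)] linear_neg[OF L(1)])
  then show ?thesis
    unfolding diffeomorphism_def using bij smooth_map_affine[OF L(1)] smooth_map_affine[OF M(1)] by metis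
qed

text \<open>
  The rigid motion applies U and then the left translation by (b, 0). The group law adds to the real
  coordinate the term \<open>Im (herm b (U (cproj p)))\<close>, which is linear in p. So the motion is
  affine, and this linear part is its derivative at every point.
\<close>

definition motion_linear :: "(complex^'n::finite \<Rightarrow> complex^'n) \<Rightarrow> complex^'n \<Rightarrow> 'n heis \<Rightarrow> 'n heis" where
  "motion_linear U b p = of_cproj (U (cproj p)) (zc p + Im (herm b (U (cproj p))))"

definition motion :: "(complex^'n::finite \<Rightarrow> complex^'n) \<Rightarrow> complex^'n \<Rightarrow> 'n heis \<Rightarrow> 'n heis" where
  "motion U b p = of_cproj b 0 + motion_linear U b p"

lemma cproj_motion: "cproj (motion U b p) = b + U (cproj p)"
  and zc_motion: "zc (motion U b p) = zc p + Im (herm b (U (cproj p)))"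
  by (simp_all add: motion_def motion_linear_def cproj_add zc_add)

locale unitary =
  fixes U :: "complex^'n::finite \<Rightarrow> complex^'n"
  assumes add: "U (a + b) = U a + U b"
    and scale: "U (s *s a) = s *s U a"
    and herm: "herm (U a) (U b) = herm a b"
begin

lemma scaleR: "U (r *\<^sub>R a) = r *\<^sub>R U a"
  by (simp add: scaleR_eq_scalar_mult scale)

lemma linear_motion_linear: "linear (motion_linear U b)"
  by (rule linearI)
    (simp_all add: motion_linear_def heis_eq_iff cproj_add cproj_scaleR zc_add zc_scaleR add scaleR
      herm_add_right herm_def sum.distrib sum_distrib_left algebra_simps)

lemma inj_motion_linear: "inj (motion_linear U b)"
  unfolding linear_injective_0[OF linear_motion_linear]
proof (intro allI impI)
  fix p assume "motion_linear U b p = 0"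
  moreover have "cproj (0 :: 'n heis) = 0" "zc (0 :: 'n heis) = 0"
    by (simp_all add: cproj_def zc_def xc_def yc_def vec_eq_iff complex_eq_iff)
  ultimately have U0: "U (cproj p) = 0" and z: "zc p + Im (herm b (U (cproj p))) = 0"
    by (auto simp: motion_linear_def heis_eq_iff)
  have "herm (cproj p) (cproj p) = 0"
    using herm[of "cproj p" "cproj p"] by (simp add: U0 herm_self)
  then have "cproj p = 0" by (simp add: herm_self)
  then show "p = 0" using z U0 \<open>cproj 0 = 0\<close> \<open>zc 0 = 0\<close> by (simp add: heis_eq_iff herm_def)
qed

text \<open>
  The base point moves by b, which shifts the contact form by the pairing of b with the image of the tangent
  vector; the shear in the real coordinate of the linear part compensates exactly this change.
\<close>

lemma theta_motion: "theta (motion U b p) (motion_linear U b v) = theta p v"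
  by (simp add: theta_eq cproj_motion motion_linear_def herm_add_left herm)

lemma frechet_derivative_motion: "frechet_derivative (motion U b) (at p) = motion_linear U b"
  using frechet_derivative_affine[OF linear_motion_linear] by (simp add: motion_def[abs_def])

text \<open>
  Contact planes are kernels of theta, so preservation of theta together with surjectivity
  of the linear part gives preservation of the planes; compatibility with J is complex linearity
  of U.
\<close>

lemma motion_in_PSH: "motion U b \<in> PSH"
proof -
  have dif: "diffeomorphism (motion U b)"
    using diffeomorphism_affine[OF linear_motion_linear inj_motion_linear]
    by (simp add: motion_def[abs_def])
  have surj: "surj (motion_linear U b)"
    using linear_injective_imp_surjective[OF linear_motion_linear inj_motion_linear] by simp
  have img: "motion_linear U b ` xi p = xi (motion U b p)" for p
  proof
    show "xi (motion U b p) \<subseteq> motion_linear U b ` xi p"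
    proof
      fix v assume v: "v \<in> xi (motion U b p)"
      obtain u where "v = motion_linear U b u" using surj by (metis surjD)
      then show "v \<in> motion_linear U b ` xi p" using v by (auto simp: xi_eq_kernel theta_motion)
    qed
  qed (auto simp: xi_eq_kernel theta_motion)
  have "motion_linear U b (J p v) = J (motion U b p) (motion_linear U b v)" for p v
  proof (rule xi_eqI)
    show "motion_linear U b (J p v) \<in> xi (motion U b p)"
      using img J_in_xi by blast
    show "cproj (motion_linear U b (J p v)) = cproj (J (motion U b p) (motion_linear U b v))"
      by (simp add: cproj_J motion_linear_def scale)
  qed (rule J_in_xi)
  then show ?thesis
    using dif img by (simp add: PSH_def frechet_derivative_motion theta_motion)
qed

lemma motion_linear_Tfield: "motion_linear U b (Tfield p) = Tfield q"
proof -
  have T: "cproj (Tfield p) = 0" "zc (Tfield p) = 1" for p :: "'n heis"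
    by (simp_all add: cproj_def Tfield_def xc_def yc_def zc_def vec_eq_iff complex_eq_iff)
  have "U 0 = 0" using scale[of 0 0] by simp
  then show ?thesis by (simp add: heis_eq_iff motion_linear_def T herm_def)
qed

lemma xi_part_motion:
  "xi_part (motion U b p) (motion_linear U b v) = motion_linear U b (xi_part p v)"
  by (simp add: xi_part_def theta_motion linear_diff[OF linear_motion_linear]
      linear_scale[OF linear_motion_linear] motion_linear_Tfield[of _ _ "motion U b p"])

lemma horizontally_regular_motion:
  assumes I: "curve_interval I" and \<gamma>: "horizontally_regular I \<gamma>"
  shows "horizontally_regular I (\<lambda>t. motion U b (\<gamma> t))"
proof -
  have bl: "bounded_linear (motion_linear U b)"
    using linear_motion_linear by (simp add: linear_conv_bounded_linear)
  have sm: "smooth_curve I \<gamma>" using \<gamma> by (simp add: horizontally_regular_def)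
  have d: "nderiv I 1 (\<lambda>t. motion U b (\<gamma> t)) t = motion_linear U b (nderiv I 1 \<gamma> t)"
    if "t \<in> I" for t
    using nderiv_affine[OF I sm bl that, of 1] unfolding motion_def by simp
  have nz: "motion_linear U b v \<noteq> 0" if "v \<noteq> 0" for v
    using that inj_motion_linear linear_injective_0[OF linear_motion_linear] by blast
  show ?thesis
    unfolding horizontally_regular_def
  proof (intro conjI ballI)
    show "smooth_curve I (\<lambda>t. motion U b (\<gamma> t))"
      unfolding motion_def by (rule smooth_curve_affine[OF I sm bl])
    fix t assume t: "t \<in> I"
    show "xi_part (motion U b (\<gamma> t)) (nderiv I 1 (\<lambda>t. motion U b (\<gamma> t)) t) \<noteq> 0"
      unfolding d[OF t] xi_part_motion
      using \<gamma> t by (intro nz) (simp add: horizontally_regular_def)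
  qed
qed

end

theorem proposition1p6:
  fixes \<gamma> :: "real \<Rightarrow> 'n::{finite,linorder} heis" and I :: "real set"
  assumes "curve_interval I"
    and "horizontally_regular I \<gamma>"
    and "degenerate I \<gamma>"
  shows "\<exists>\<Phi>\<in>PSH. \<exists>\<gamma>'. (\<forall>t. \<gamma>' t = \<Phi> (\<gamma> t)) \<and>
           horizontally_regular I \<gamma>' \<and>
           (\<forall>t\<in>I. zc (\<gamma>' t) = zc (\<gamma> t)) \<and>
           (\<forall>t\<in>I. cproj (\<gamma>' t) $ last_index = 0) \<and>
           \<gamma>' ` I \<subseteq> sub_heis"
proof -
  let ?l = "last_index :: 'n"
  define \<beta> where "\<beta> = cproj \<circ> \<gamma>"
  have int: "is_interval I" using assms(1) by (simp add: curve_interval_def)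
  have "smooth_curve I \<gamma>" using assms(2) by (simp add: horizontally_regular_def)
  then have \<beta>: "smooth_curve I \<beta>"
    using smooth_curve_affine[OF assms(1), of \<gamma> cproj 0] linear_cproj
    by (simp add: \<beta>_def comp_def linear_conv_bounded_linear)
  obtain k where k: "has_order I \<gamma> k" "k < CARD('n)"
    using assms(3) by (auto simp: degenerate_def)
  obtain t0 where t0: "t0 \<in> I"
    using assms(1) interior_subset by (fastforce simp: curve_interval_def)
  obtain w where w: "herm w w = 1" "w $ ?l \<in> \<real>"
    and w0: "\<And>m. m \<in> {1..k} \<Longrightarrow> herm (nderiv I m \<beta> t0) w = 0"
    using exists_unit_orthogonal[OF k(2), of ?l "\<lambda>m. nderiv I m \<beta> t0"] by blast
  have vanish: "herm (nderiv I 1 \<beta> t) w = 0" if "t \<in> I" for t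
    using k(1) that
    by (intro herm_derivatives_vanish[OF int \<beta> _ _ t0 w0]) (auto simp: has_order_def \<beta>_def)
  define c where "c = herm (\<beta> t0) w"
  have const: "herm (\<beta> t) w = c" if t: "t \<in> I" for t
  proof -
    have "((\<lambda>t. herm (\<beta> t) w) has_derivative (\<lambda>h. 0)) (at s within I)" if s: "s \<in> I" for s
      using bounded_linear.has_vector_derivative[OF bounded_linear_herm_left
          smooth_curve_has_vector_derivative[OF \<beta> s, of 0], of w] vanish[OF s]
      by (simp add: has_vector_derivative_def)
    then obtain d where "\<And>s. s \<in> I \<Longrightarrow> herm (\<beta> s) w = d"
      using has_derivative_zero_constant[of I "\<lambda>t. herm (\<beta> t) w"] int
      by (auto simp: is_interval_convex)
    then show ?thesis using t t0 by (simp add: c_def)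
  qed
  define U where "U = reflect (w - axis ?l 1)"
  interpret unitary U
    by unfold_locales (simp_all add: U_def reflect_add reflect_scale herm_reflect_reflect)
  \<comment> \<open>This translation has no components in the other directions, where the
    curve is not constrained and the symplectic pairing could change z.\<close>
  define b where "b = - axis ?l c"
  define \<gamma>' where "\<gamma>' t = motion U b (\<gamma> t)" for t
  have Ul: "U (cproj (\<gamma> t)) $ ?l = c" if "t \<in> I" for t
    using const[OF that] by (simp add: U_def reflect_component[OF w] \<beta>_def)
  have last: "cproj (\<gamma>' t) $ ?l = 0" if "t \<in> I" for t
    using Ul[OF that] by (simp add: \<gamma>'_def cproj_motion b_def)
  have "herm b (U (cproj (\<gamma> t))) = - c * cnj c" if "t \<in> I" for t
  proof -
    have "herm b a = - c * cnj (a $ ?l)" for a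
      by (simp add: b_def herm_def axis_def if_distrib[of "\<lambda>u. u * _"] sum_negf cong: if_cong)
    then show ?thesis using Ul[OF that] by simp
  qed
  then have zz: "zc (\<gamma>' t) = zc (\<gamma> t)" if "t \<in> I" for t
    using that by (simp add: \<gamma>'_def zc_motion)
  have sub: "\<gamma>' ` I \<subseteq> sub_heis"
    using last by (auto simp: sub_heis_def cproj_def complex_eq_iff)
  have "horizontally_regular I \<gamma>'"
    unfolding \<gamma>'_def using assms(1,2) by (rule horizontally_regular_motion)
  then show ?thesis
    using motion_in_PSH[of b] zz last sub by (auto simp: \<gamma>'_def intro!: bexI[of _ "motion U b"] exI[of _ \<gamma>'])
qed

end
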